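(* The formulas $$\cos r=\operatorname{sn}(\beta,q),\qquad \sin r=\operatorname{cn}(\beta,q),\qquad \sin R=\operatorname{dn}(\beta,q)$$ describe a one-to-one correspondence between the radii $(r,R)\in[-\pi,\pi]\times[R_0,\pi-R_0]$ of a spherical ring with the parameter $q\le1$ given by $q\cos r=\cos R$ and the variable $\beta\in[0,4K]$ of Jacobi functions of modulus $q$. Here $R_0=\arccos q$.
   Context: $\operatorname{sn},\operatorname{cn},\operatorname{dn}$ are the Jacobi elliptic functions of modulus $q$; they are doubly periodic on the rectangular torus with the lattice given by the real period $4K$ and the imaginary period $4iK'$, where $K,K'$ are the complete elliptic integrals of the first kind of modulus $q$ and of the complementary modulus. A spherical ring is a pair of concentric circles on $S^2$ forming an annulus, with inner spherical radius $r$ (signed, the sign encoding orientation) and outer spherical radius $R>0$. All rings of an orthogonal ring pattern (neighboring rings intersect orthogonally, i.e. the outer circle of each intersects the inner circle of the other orthogonally) satisfy $q\cos r=\cos R$ with one global constant $q\le1$. This relation is imposed together with the displayed formulas and selects $R$ between the two solutions $R$, $\pi-R$ of $\sin R=\operatorname{dn}(\beta,q)$.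
   Formalization: Proved for 0 ≤ q < 1 (at q = 1, K is infinite and sin r < 0 is never attained; for q < 0 the interval [R_0, π−R_0] is empty or undefined), and with the end points β = 0, 4K and r = −π, π identified, since the formulas do not distinguish them. *)

theory Defs
  imports "HOL-Analysis.Analysis" "HOL-Library.Real_Mod"
begin

section \<open>Jacobi elliptic functions of a real argument\<close>

text \<open>
  The argument \<open>q\<close> is always the modulus (not the parameter \<open>m = q\<^sup>2\<close>), with \<open>\<bar>q\<bar> < 1\<close>.
  The interval integral is oriented, so \<open>elliptic_F q\<close> is an odd function on all of \<open>\<real>\<close>.
\<close>

definition elliptic_F :: "real \<Rightarrow> real \<Rightarrow> real" where
  "elliptic_F q \<phi> = (LBINT \<theta>=0..\<phi>. 1 / sqrt (1 - q\<^sup>2 * (sin \<theta>)\<^sup>2))"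

definition elliptic_K :: "real \<Rightarrow> real" where
  "elliptic_K q = elliptic_F q (pi / 2)"

definition jacobi_am :: "real \<Rightarrow> real \<Rightarrow> real" where
  "jacobi_am q = inv (elliptic_F q)"

definition jacobi_sn :: "real \<Rightarrow> real \<Rightarrow> real" where
  "jacobi_sn q \<beta> = sin (jacobi_am q \<beta>)"

definition jacobi_cn :: "real \<Rightarrow> real \<Rightarrow> real" where
  "jacobi_cn q \<beta> = cos (jacobi_am q \<beta>)"

definition jacobi_dn :: "real \<Rightarrow> real \<Rightarrow> real" where
  "jacobi_dn q \<beta> = sqrt (1 - q\<^sup>2 * (jacobi_sn q \<beta>)\<^sup>2)"

text \<open>For \<open>\<bar>q\<bar> < 1\<close> the inverse in the definition of the amplitude is a genuine two-sided inverse.\<close>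

lemma elliptic_F_radicand_pos:
  fixes q \<theta> :: real
  assumes "\<bar>q\<bar> < 1"
  shows "0 < 1 - q\<^sup>2 * (sin \<theta>)\<^sup>2"
proof -
  have "(sin \<theta>)\<^sup>2 \<le> 1" by (simp add: abs_square_le_1)
  then have "q\<^sup>2 * (sin \<theta>)\<^sup>2 \<le> q\<^sup>2 * 1" by (intro mult_left_mono) auto
  moreover have "q\<^sup>2 < 1" using assms by (simp add: abs_square_less_1)
  ultimately show ?thesis by linarith
qed

lemma elliptic_F_has_real_derivative:
  assumes "\<bar>q\<bar> < 1"
  shows "(elliptic_F q has_real_derivative 1 / sqrt (1 - q\<^sup>2 * (sin \<phi>)\<^sup>2)) (at \<phi>)"
proof -
  define f where "f = (\<lambda>\<theta>. 1 / sqrt (1 - q\<^sup>2 * (sin \<theta>)\<^sup>2))"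
  have pos: "0 < 1 - q\<^sup>2 * (sin \<theta>)\<^sup>2" for \<theta>
    by (rule elliptic_F_radicand_pos[OF assms])
  have cont: "continuous_on A f" for A
    unfolding f_def by (intro continuous_intros ballI) (use pos less_irrefl real_sqrt_eq_0_iff in metis)
  then have "isCont f x" for x
    using continuous_on_eq_continuous_at[of UNIV f] by auto
  then obtain G where G: "\<And>x. (G has_vector_derivative f x) (at x)"
    using einterval_antiderivative[of "-\<infinity>" "\<infinity>" f] by auto
  have "elliptic_F q x = G x - G 0" for x
    unfolding elliptic_F_def f_def[symmetric] zero_ereal_def
    by (rule interval_integral_FTC_finite[OF cont])
       (auto intro: has_vector_derivative_at_within G)
  then have "elliptic_F q = (\<lambda>x. G x - G 0)" by auto
  moreover have "(G has_real_derivative f \<phi>) (at \<phi>)"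
    using G by (simp add: has_real_derivative_iff_has_vector_derivative)
  ultimately show ?thesis
    by (auto simp: f_def intro!: derivative_eq_intros)
qed

lemma elliptic_F_0 [simp]: "elliptic_F q 0 = 0"
  by (simp add: elliptic_F_def flip: zero_ereal_def)

lemma bij_elliptic_F:
  assumes "\<bar>q\<bar> < 1"
  shows "bij (elliptic_F q)"
proof -
  define g where "g = (\<lambda>x. elliptic_F q x - x)"
  have ge1: "1 \<le> 1 / sqrt (1 - q\<^sup>2 * (sin x)\<^sup>2)" for x
    using elliptic_F_radicand_pos[OF assms, of x] by simp
  have deriv: "(g has_real_derivative 1 / sqrt (1 - q\<^sup>2 * (sin x)\<^sup>2) - 1) (at x)" for x
    unfolding g_def
    by (intro derivative_intros elliptic_F_has_real_derivative assms)
  have mono: "g x \<le> g y" if "x \<le> y" for x y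
    by (rule DERIV_nonneg_imp_nondecreasing[OF that]) (use deriv ge1 diff_ge_0_iff_ge in blast)
  have "strict_mono (elliptic_F q)"
  proof (rule strict_monoI)
    fix x y :: real
    assume "x < y"
    then show "elliptic_F q x < elliptic_F q y"
      using mono[of x y] by (simp add: g_def)
  qed
  moreover have "\<exists>x. elliptic_F q x = y" for y
  proof -
    have c: "continuous_on A (elliptic_F q)" for A
      by (meson DERIV_isCont assms continuous_at_imp_continuous_on
          elliptic_F_has_real_derivative)
    have "elliptic_F q (- \<bar>y\<bar>) \<le> y" "y \<le> elliptic_F q \<bar>y\<bar>"
      using mono[of "- \<bar>y\<bar>" 0] mono[of 0 "\<bar>y\<bar>"] by (auto simp: g_def)
    then show ?thesis
      using IVT'[of "elliptic_F q" "- \<bar>y\<bar>" y "\<bar>y\<bar>", OF _ _ _ c] by auto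
  qed
  ultimately show ?thesis
    unfolding bij_def surj_def by (simp add: strict_mono_imp_inj_on) (metis)
qed


section \<open>Radii of a spherical ring and the Jacobi variable\<close>

definition ring_radii :: "real \<Rightarrow> (real \<times> real) set" where
  "ring_radii q = {(r, R). r \<in> {-pi..pi} \<and> R \<in> {arccos q..pi - arccos q} \<and> q * cos r = cos R}"

text \<open>
  The signed inner radius is an angle and \<open>\<beta>\<close> lives on a torus with real period \<open>4K\<close>, so in the
  closed intervals \<open>[-\<pi>, \<pi>]\<close> and \<open>[0, 4K]\<close> the two end points denote the same object. The following
  relations make exactly these identifications; on the intervals, they identify nothing else.
\<close>

definition radii_equiv :: "real \<Rightarrow> ((real \<times> real) \<times> (real \<times> real)) set" where
  "radii_equiv q = {((r, R), (r', R')). (r, R) \<in> ring_radii q \<and> (r', R') \<in> ring_radii q \<and>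
     [r = r'] (rmod (2 * pi)) \<and> R = R'}"

definition period_equiv :: "real \<Rightarrow> (real \<times> real) set" where
  "period_equiv q = {(\<beta>, \<beta>'). \<beta> \<in> {0..4 * elliptic_K q} \<and> \<beta>' \<in> {0..4 * elliptic_K q} \<and>
     [\<beta> = \<beta>'] (rmod (4 * elliptic_K q))}"

lemma equiv_radii_equiv: "equiv (ring_radii q) (radii_equiv q)"
  by (rule equivI)
     (auto simp: radii_equiv_def refl_on_def sym_def trans_def intro: rcong_sym rcong_trans)

lemma equiv_period_equiv: "equiv {0..4 * elliptic_K q} (period_equiv q)"
  by (rule equivI)
     (auto simp: period_equiv_def refl_on_def sym_def trans_def intro: rcong_sym rcong_trans)

definition ring_jacobi :: "real \<Rightarrow> (real \<times> (real \<times> real)) set" where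
  "ring_jacobi q = {(\<beta>, (r, R)). \<beta> \<in> {0..4 * elliptic_K q} \<and> (r, R) \<in> ring_radii q \<and>
     cos r = jacobi_sn q \<beta> \<and> sin r = jacobi_cn q \<beta> \<and> sin R = jacobi_dn q \<beta>}"

end

theory Submission
  imports Defs
begin

text \<open>
  Both sides are the unit circle in disguise. On the Jacobi side, the amplitude is the inverse of
  \<open>elliptic_F q\<close>, an increasing bijection of \<open>\<real>\<close> that turns the shift by \<open>2\<pi>\<close> into the shift by
  \<open>4K\<close> (lemma \<open>rcong_jacobi_am_iff\<close>). Hence \<open>\<beta>\<close> modulo \<open>4K\<close> is the same datum as the point
  \<open>sn \<beta> + i cn \<beta>\<close> of the unit circle, and every point occurs. On the ring side,
  the constraint \<open>q cos r = cos R\<close> with \<open>0 \<le> R \<le> \<pi>\<close> forces \<open>R = arccos (q cos r)\<close>, and this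
  value always lies in \<open>[R\<^sub>0, \<pi> - R\<^sub>0]\<close> because \<open>\<bar>q cos r\<bar> \<le> q\<close> (lemma \<open>ring_radii_iff\<close>).
  So a ring is the angle \<open>r\<close> modulo \<open>2\<pi>\<close>, that is, the point \<open>cos r + i sin r\<close>.

  The first two formulas say that the two points coincide, and then the third one holds by itself:
  \<open>sin R = sqrt (1 - q\<^sup>2 cos\<^sup>2 r) = sqrt (1 - q\<^sup>2 sn\<^sup>2 \<beta>) = dn \<beta>\<close>. The relation between \<open>\<beta>\<close> and
  \<open>(r, R)\<close> is therefore equality of two maps onto the circle whose fibres are the equivalence
  classes, and \<open>bij_betw_quotient_kernels\<close> applies.
\<close>

text \<open>
  Both quotients are identified with the common image of \<open>f\<close> and \<open>g\<close>, and the relation \<open>T\<close> matches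
  the fibre of \<open>f\<close> over a point with the fibre of \<open>g\<close> over the same point.
\<close>

lemma bij_betw_quotient_kernels:
  fixes f :: "'a \<Rightarrow> 'c" and g :: "'b \<Rightarrow> 'c"
  assumes E: "E = {(a, a'). a \<in> A \<and> a' \<in> A \<and> f a = f a'}"
    and E': "E' = {(b, b'). b \<in> B \<and> b' \<in> B \<and> g b = g b'}"
    and T: "T = {(a, b). a \<in> A \<and> b \<in> B \<and> f a = g b}"
    and img: "f ` A = g ` B"
  shows "bij_betw (\<lambda>X. T `` X) (A // E) (B // E')"
proof -
  define fibA where "fibA = (\<lambda>z. {a \<in> A. f a = z})"
  define fibB where "fibB = (\<lambda>z. {b \<in> B. g b = z})"
  have "E `` {a} = fibA (f a)" if "a \<in> A" for a
    using that by (auto simp: E fibA_def)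
  then have quotA: "A // E = fibA ` f ` A"
    by (auto simp: quotient_def)
  have "E' `` {b} = fibB (g b)" if "b \<in> B" for b
    using that by (auto simp: E' fibB_def)
  then have quotB: "B // E' = fibB ` f ` A"
    unfolding img by (auto simp: quotient_def)
  have T_fib: "T `` fibA z = fibB z" if "z \<in> f ` A" for z
    using that by (auto simp: T fibA_def fibB_def)
  have inj: "inj_on fibB (f ` A)"
    unfolding img by (auto simp: inj_on_def fibB_def)
  show ?thesis
    unfolding quotA quotB bij_betw_def
  proof
    show "inj_on ((``) T) (fibA ` f ` A)"
      by (rule inj_on_imageI) (use inj T_fib in \<open>auto simp: inj_on_def\<close>)
    show "(``) T ` fibA ` f ` A = fibB ` f ` A"
      unfolding image_image[of _ fibA] by (rule image_cong) (simp_all add: T_fib)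
  qed
qed

text \<open>
  The integrand is even and \<open>\<pi>\<close>-periodic, so \<open>F (\<phi> + \<pi>) - F \<phi>\<close> and \<open>F \<phi> + F (-\<phi>)\<close> have derivative
  zero; the value at \<open>\<phi> = -\<pi>/2\<close> of the first is \<open>2 F (\<pi>/2)\<close>.
\<close>

lemma elliptic_F_plus_pi:
  assumes "\<bar>q\<bar> < 1"
  shows "elliptic_F q (\<phi> + pi) = elliptic_F q \<phi> + 2 * elliptic_K q"
proof -
  note deriv = elliptic_F_has_real_derivative[OF assms]
  have shift: "((\<lambda>x. elliptic_F q (x + pi) - elliptic_F q x) has_real_derivative 0) (at x)" for x
    by (rule DERIV_cong, rule derivative_intros,
        rule DERIV_chain'[where g = "elliptic_F q" and f = "\<lambda>x. x + pi", OF _ deriv])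
       (auto intro!: derivative_eq_intros deriv)
  have refl: "((\<lambda>x. elliptic_F q x + elliptic_F q (- x)) has_real_derivative 0) (at x)" for x
    by (rule DERIV_cong, rule derivative_intros, rule deriv,
        rule DERIV_chain'[where g = "elliptic_F q" and f = uminus, OF _ deriv])
       (auto intro!: derivative_eq_intros)
  have "elliptic_F q (\<phi> + pi) - elliptic_F q \<phi> = elliptic_F q (- pi / 2 + pi) - elliptic_F q (- pi / 2)"
    using DERIV_isconst_all[of "\<lambda>x. elliptic_F q (x + pi) - elliptic_F q x" \<phi> "- pi / 2"] shift
    by blast
  moreover have "elliptic_F q (pi / 2) + elliptic_F q (- (pi / 2)) = elliptic_F q 0 + elliptic_F q (- 0)"
    using DERIV_isconst_all[of "\<lambda>x. elliptic_F q x + elliptic_F q (- x)" "pi / 2" 0] refl by blast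
  moreover have "- pi / 2 + pi = pi / 2"
    by simp
  ultimately show ?thesis
    by (simp add: elliptic_K_def)
qed

lemma elliptic_F_plus_int_pi:
  assumes "\<bar>q\<bar> < 1"
  shows "elliptic_F q (\<phi> + of_int n * pi) = elliptic_F q \<phi> + of_int n * (2 * elliptic_K q)"
proof (induction n rule: int_induct[where k = 0])
  case base
  show ?case by simp
next
  case (step1 n)
  then show ?case
    using elliptic_F_plus_pi[OF assms, of "\<phi> + of_int n * pi"] by (simp add: algebra_simps)
next
  case (step2 n)
  then show ?case
    using elliptic_F_plus_pi[OF assms, of "\<phi> + of_int (n - 1) * pi"] by (simp add: algebra_simps)
qed

lemma rcong_elliptic_F_iff:
  assumes "\<bar>q\<bar> < 1"
  shows "[elliptic_F q \<phi> = elliptic_F q \<psi>] (rmod (4 * elliptic_K q)) \<longleftrightarrow> [\<phi> = \<psi>] (rmod (2 * pi))"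
proof -
  have "elliptic_F q \<phi> + of_int n * (4 * elliptic_K q) = elliptic_F q (\<phi> + of_int n * (2 * pi))" for n
    using elliptic_F_plus_int_pi[OF assms, of \<phi> "2 * n"] by (simp add: algebra_simps)
  then show ?thesis
    by (simp add: rcong_altdef bij_is_inj[OF bij_elliptic_F[OF assms], THEN inj_eq])
qed

lemma elliptic_F_jacobi_am:
  "\<bar>q\<bar> < 1 \<Longrightarrow> elliptic_F q (jacobi_am q \<beta>) = \<beta>"
  unfolding jacobi_am_def by (simp add: surj_f_inv_f bij_is_surj bij_elliptic_F)

lemma jacobi_am_elliptic_F:
  "\<bar>q\<bar> < 1 \<Longrightarrow> jacobi_am q (elliptic_F q \<phi>) = \<phi>"
  unfolding jacobi_am_def by (simp add: inv_f_f bij_is_inj bij_elliptic_F)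

lemma rcong_jacobi_am_iff:
  assumes "\<bar>q\<bar> < 1"
  shows "[jacobi_am q \<beta> = jacobi_am q \<beta>'] (rmod (2 * pi)) \<longleftrightarrow> [\<beta> = \<beta>'] (rmod (4 * elliptic_K q))"
  using rcong_elliptic_F_iff[OF assms, of "jacobi_am q \<beta>" "jacobi_am q \<beta>'"]
  by (simp add: elliptic_F_jacobi_am[OF assms])

lemma elliptic_K_pos:
  assumes "\<bar>q\<bar> < 1"
  shows "0 < elliptic_K q"
proof -
  have "elliptic_F q 0 < elliptic_F q (pi / 2)"
  proof (rule DERIV_pos_imp_increasing[where f = "elliptic_F q"])
    fix x
    show "\<exists>y. (elliptic_F q has_real_derivative y) (at x) \<and> 0 < y"
      using elliptic_F_has_real_derivative[OF assms, of x] elliptic_F_radicand_pos[OF assms, of x]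
      by (intro exI conjI) auto
  qed simp
  then show ?thesis
    by (simp add: elliptic_K_def)
qed

text \<open>
  The point \<open>sn \<beta> + i cn \<beta>\<close> is \<open>cis (\<pi>/2 - am \<beta>)\<close>: sine and cosine are interchanged in the formulas
  for \<open>r\<close>, so \<open>r\<close> is the complement of the amplitude.
\<close>

lemma cis_complement_am:
  "cis (pi / 2 - jacobi_am q \<beta>) = Complex (jacobi_sn q \<beta>) (jacobi_cn q \<beta>)"
  by (simp add: complex_eq_iff jacobi_sn_def jacobi_cn_def cos_diff sin_diff)

lemma cis_am_image:
  assumes "\<bar>q\<bar> < 1"
  shows "(\<lambda>\<beta>. cis (pi / 2 - jacobi_am q \<beta>)) ` {0..4 * elliptic_K q} = range cis"
proof (intro equalityI subsetI)
  fix z assume "z \<in> range cis"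
  then obtain t where z: "z = cis t" by blast
  have K: "0 < 4 * elliptic_K q"
    using elliptic_K_pos[OF assms] by simp
  define \<beta> where "\<beta> = elliptic_F q (pi / 2 - t) rmod (4 * elliptic_K q)"
  have "\<beta> \<in> {0..4 * elliptic_K q}"
    unfolding \<beta>_def using K by (simp add: rmod_nonneg rmod_le)
  moreover have "[jacobi_am q \<beta> = jacobi_am q (elliptic_F q (pi / 2 - t))] (rmod (2 * pi))"
    by (simp add: rcong_jacobi_am_iff[OF assms] \<beta>_def)
  then have "[pi / 2 - jacobi_am q \<beta> = pi / 2 - (pi / 2 - t)] (rmod (2 * pi))"
    by (simp only: jacobi_am_elliptic_F[OF assms] rcong_diff_left_cancel)
  then have "z = cis (pi / 2 - jacobi_am q \<beta>)"
    by (simp add: z cis_eq_iff rcong_sym_iff)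
  ultimately show "z \<in> (\<lambda>\<beta>. cis (pi / 2 - jacobi_am q \<beta>)) ` {0..4 * elliptic_K q}"
    by blast
qed auto

text \<open>
  The interval for \<open>R\<close> lies in \<open>[0, \<pi>]\<close>, where the cosine is injective, and its end points
  \<open>arccos (\<plusminus>q)\<close> are the extreme values of \<open>arccos (q cos r)\<close>.
\<close>

lemma ring_radii_iff:
  assumes "0 \<le> q" "q \<le> 1"
  shows "(r, R) \<in> ring_radii q \<longleftrightarrow> r \<in> {-pi..pi} \<and> R = arccos (q * cos r)"
proof -
  have "\<bar>q * cos r\<bar> \<le> q * 1"
    unfolding abs_mult using assms by (intro mult_mono) auto
  then have bounds: "- q \<le> q * cos r" "q * cos r \<le> q"
    by auto
  then have "arccos q \<le> arccos (q * cos r)" "arccos (q * cos r) \<le> arccos (- q)"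
    using assms by (auto intro!: arccos_le_arccos)
  moreover have "arccos (- q) = pi - arccos q"
    using assms by (intro arccos_minus) auto
  moreover have "cos (arccos (q * cos r)) = q * cos r"
    using assms bounds by (intro cos_arccos) auto
  moreover have "R = arccos (q * cos r)"
    if "arccos q \<le> R" "R \<le> pi - arccos q" "q * cos r = cos R"
    using that assms arccos_lbound[of q] arccos_cos[of R] by simp
  ultimately show ?thesis
    by (auto simp: ring_radii_def)
qed

lemma cis_radii_image:
  assumes "0 \<le> q" "q \<le> 1"
  shows "(\<lambda>(r, R). cis r) ` ring_radii q = range cis"
proof (intro equalityI subsetI)
  fix z assume "z \<in> range cis"
  then obtain t where z: "z = cis t" by blast
  obtain r where "- pi < r" "r \<le> pi" "sin r = sin t" "cos r = cos t"
    using sincos_principal_value[of t] by blast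
  then have "(r, arccos (q * cos r)) \<in> ring_radii q" "cis r = z"
    by (auto simp: ring_radii_iff[OF assms] z complex_eq_iff)
  then show "z \<in> (\<lambda>(r, R). cis r) ` ring_radii q"
    by (force simp: image_iff)
qed auto

lemma radii_equiv_eq_cis_kernel:
  assumes "0 \<le> q" "q \<le> 1"
  shows "radii_equiv q = {(p, p'). p \<in> ring_radii q \<and> p' \<in> ring_radii q \<and>
    (\<lambda>(r, R). cis r) p = (\<lambda>(r, R). cis r) p'}"
proof -
  have "R = R'" if "(r, R) \<in> ring_radii q" "(r', R') \<in> ring_radii q" "cis r = cis r'" for r R r' R'
    using that by (auto simp: ring_radii_iff[OF assms] complex_eq_iff)
  then show ?thesis
    by (auto simp: radii_equiv_def cis_eq_iff)
qed

lemma period_equiv_eq_cis_kernel: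
  assumes "\<bar>q\<bar> < 1"
  shows "period_equiv q = {(\<beta>, \<beta>'). \<beta> \<in> {0..4 * elliptic_K q} \<and> \<beta>' \<in> {0..4 * elliptic_K q} \<and>
    cis (pi / 2 - jacobi_am q \<beta>) = cis (pi / 2 - jacobi_am q \<beta>')}"
  by (simp add: period_equiv_def cis_eq_iff rcong_jacobi_am_iff[OF assms])

lemma ring_jacobi_eq_cis:
  assumes "0 \<le> q" "q \<le> 1"
  shows "ring_jacobi q = {(\<beta>, p). \<beta> \<in> {0..4 * elliptic_K q} \<and> p \<in> ring_radii q \<and>
    cis (pi / 2 - jacobi_am q \<beta>) = (\<lambda>(r, R). cis r) p}"
proof -
  have "sin R = jacobi_dn q \<beta>"
    if "(r, R) \<in> ring_radii q" "jacobi_sn q \<beta> = cos r" for r R \<beta>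
  proof -
    have "\<bar>q * cos r\<bar> \<le> 1 * 1"
      unfolding abs_mult using assms by (intro mult_mono) auto
    then have "sin (arccos (q * cos r)) = sqrt (1 - (q * cos r)\<^sup>2)"
      by (intro sin_arccos) auto
    with that show ?thesis
      by (simp add: ring_radii_iff[OF assms] jacobi_dn_def power_mult_distrib)
  qed
  then show ?thesis
    by (auto simp: ring_jacobi_def cis_complement_am complex_eq_iff)
qed

theorem proposition2p3:
  fixes q :: real
  assumes "0 \<le> q" and "q < 1"
  shows "bij_betw (\<lambda>B. ring_jacobi q `` B)
    ({0..4 * elliptic_K q} // period_equiv q)
    (ring_radii q // radii_equiv q)"
proof -
  have q: "\<bar>q\<bar> < 1" "q \<le> 1"
    using assms by auto
  show ?thesis
  proof (rule bij_betw_quotient_kernels)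
    show "(\<lambda>\<beta>. cis (pi / 2 - jacobi_am q \<beta>)) ` {0..4 * elliptic_K q} = (\<lambda>(r, R). cis r) ` ring_radii q"
      by (simp only: cis_am_image[OF q(1)] cis_radii_image[OF assms(1) q(2)])
  qed (fact period_equiv_eq_cis_kernel[OF q(1)] radii_equiv_eq_cis_kernel[OF assms(1) q(2)]
        ring_jacobi_eq_cis[OF assms(1) q(2)])+
qed

end
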